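(* For all positive integers $k$, $r$ and $c$, there is an integer $N$ such that every set $A$ of $N$ lines in $\mathbb{R}^2$ in which no $r+1$ lines pass through a common point contains pairwise disjoint subsets $A_1,\dots,A_k$ with $|A_i|\ge c$ for all $i$, such that every transversal of $CH(A_1),\dots,CH(A_k)$ is in convex position.
   Context: For a finite set $A$ of lines in $\mathbb{R}^2$, $V(A)$ is the set of intersection points of pairs of lines of $A$ and $CH(A)$ is the convex hull of $V(A)$. A transversal of sets $X_1,\dots,X_k$ is a $k$-tuple $(x_1,\dots,x_k)$ with $x_i\in X_i$. A finite point set is in convex position if each of its points is a vertex of its convex hull. *)

theory Defs
  imports "HOL-Analysis.Analysis"
begin

type_synonym point = "real ^ 2"

definition is_line :: "point set \<Rightarrow> bool" where
  "is_line L \<longleftrightarrow> (\<exists>a b. b \<noteq> 0 \<and> L = {a + t *\<^sub>R b | t. True})"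

definition V :: "point set set \<Rightarrow> point set" where
  "V A = {p. \<exists>L\<in>A. \<exists>M\<in>A. L \<noteq> M \<and> p \<in> L \<and> p \<in> M}"

definition CH :: "point set set \<Rightarrow> point set" where
  "CH A = convex hull (V A)"

definition convex_position :: "point set \<Rightarrow> bool" where
  "convex_position S \<longleftrightarrow> finite S \<and> (\<forall>x\<in>S. x extreme_point_of (convex hull S))"

end

theory Submission
  imports Defs "HOL-Library.Ramsey"
begin

(* Lines y = a x + b are treated through point-line duality: the line
   corresponds to the point (a, b), the intersection of two lines i, j lies above the test line
   y = m x + q exactly when the chord through the dual points i, j passes above (m, q).

   1. For a cup (increasing consecutive slopes) with increasing abscissae, every block of
      consecutive points with a neighbour on each side can be separated: some (m, q) lies below
      all chords inside the block and above all chords lying entirely left or right of it.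
      Caps reduce to cups by reflection.
   2. Consequently, if the dual points of the lines form a cup or a cap, the sets CH of blocks
      of c consecutive lines are pairwise separated by lines, and every transversal is in convex
      position.
   3. Ramsey's theorem for triples yields, in any long sequence of dual points ordered by
      slope, a long subsequence which is a cup, a cap or collinear; collinear dual points are
      concurrent lines, excluded by the multiplicity bound r.
   4. A large set of lines either contains many pairwise parallel lines (then all V(A_i) are
      empty and the statement holds vacuously) or has many distinct slopes (then 3 and 2 apply). *)

definition slope :: "(nat \<Rightarrow> real) \<Rightarrow> (nat \<Rightarrow> real) \<Rightarrow> nat \<Rightarrow> nat \<Rightarrow> real" where
  "slope a b i j = (b j - b i) / (a j - a i)"

definition chord :: "(nat \<Rightarrow> real) \<Rightarrow> (nat \<Rightarrow> real) \<Rightarrow> nat \<Rightarrow> nat \<Rightarrow> real \<Rightarrow> real" where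
  "chord a b i j x = b i + slope a b i j * (x - a i)"

lemma chord_shift: "chord a b i j x = chord a b i j y + slope a b i j * (x - y)"
  unfolding chord_def by (simp add: algebra_simps)

lemma chord_left_end: "chord a b i j (a i) = b i"
  unfolding chord_def by simp

lemma chord_right_end: "a i \<noteq> a j \<Longrightarrow> chord a b i j (a j) = b j"
  unfolding chord_def slope_def by (simp add: field_simps)

lemma slope_neg: "slope a (\<lambda>i. - b i) i j = - slope a b i j"
  unfolding slope_def by (metis minus_diff_eq minus_diff_minus minus_divide_left)

lemma chord_neg: "chord a (\<lambda>i. - b i) i j x = - chord a b i j x"
  unfolding chord_def slope_neg by simp

definition is_cup :: "(nat \<Rightarrow> real) \<Rightarrow> (nat \<Rightarrow> real) \<Rightarrow> nat \<Rightarrow> bool" where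
  "is_cup a b n \<longleftrightarrow> (\<forall>i j l. i < j \<longrightarrow> j < l \<longrightarrow> l < n \<longrightarrow> slope a b i j < slope a b j l)"

definition is_cap :: "(nat \<Rightarrow> real) \<Rightarrow> (nat \<Rightarrow> real) \<Rightarrow> nat \<Rightarrow> bool" where
  "is_cap a b n \<longleftrightarrow> (\<forall>i j l. i < j \<longrightarrow> j < l \<longrightarrow> l < n \<longrightarrow> slope a b i j > slope a b j l)"

definition is_collinear :: "(nat \<Rightarrow> real) \<Rightarrow> (nat \<Rightarrow> real) \<Rightarrow> nat \<Rightarrow> bool" where
  "is_collinear a b n \<longleftrightarrow> (\<forall>i j l. i < j \<longrightarrow> j < l \<longrightarrow> l < n \<longrightarrow> slope a b i j = slope a b j l)"

locale cup_sequence =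
  fixes a b :: "nat \<Rightarrow> real" and n :: nat
  assumes increasing: "\<And>i j. i < j \<Longrightarrow> j < n \<Longrightarrow> a i < a j"
    and cup: "\<And>i j l. i < j \<Longrightarrow> j < l \<Longrightarrow> l < n \<Longrightarrow> slope a b i j < slope a b j l"
begin

lemma slope_between:
  assumes "i < j" "j < l" "l < n"
  shows "slope a b i j < slope a b i l" and "slope a b i l < slope a b j l"
proof -
  have a: "a i < a j" "a j < a l" using increasing assms by auto
  define s t u where "s = slope a b i j" and "t = slope a b j l" and "u = slope a b i l"
  have "b j = b i + s * (a j - a i)" "b l = b j + t * (a l - a j)" "b l = b i + u * (a l - a i)"
    using a unfolding s_def t_def u_def slope_def by (simp_all add: field_simps)
  then have weighted: "u * (a l - a i) = s * (a j - a i) + t * (a l - a j)"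
    by (simp add: algebra_simps)
  have "s < t" using cup assms unfolding s_def t_def by blast
  then have "0 < (t - s) * (a l - a j)" "0 < (t - s) * (a j - a i)" using a by simp_all
  then have "s * (a l - a i) < u * (a l - a i)" and "u * (a l - a i) < t * (a l - a i)"
    using weighted by (simp_all add: algebra_simps)
  then show "slope a b i j < slope a b i l" "slope a b i l < slope a b j l"
    using a unfolding s_def t_def u_def by (simp_all add: mult_less_cancel_right)
qed

lemma slope_mono:
  assumes "i < j" "i' < j'" "i \<le> i'" "j \<le> j'" "(i, j) \<noteq> (i', j')" "j' < n"
  shows "slope a b i j < slope a b i' j'"
proof -
  have "slope a b i j \<le> slope a b i j'"
    using slope_between(1)[of i j j'] assms by (cases "j = j'") auto
  moreover have "slope a b i j' < slope a b i' j'" if "i < i'"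
    using slope_between(2)[of i i' j'] assms that by auto
  moreover have "slope a b i j < slope a b i j'" if "j < j'"
    using slope_between(1)[of i j j'] assms that by auto
  ultimately show ?thesis using assms by (cases "i = i'") auto
qed

lemma above_chord:
  assumes "i < j" "j < n" "l < n" "l < i \<or> j < l"
  shows "chord a b i j (a l) < b l"
  using assms(4)
proof
  assume "j < l"
  have "a i < a l" using increasing assms \<open>j < l\<close> by auto
  moreover have "slope a b i j < slope a b i l" using slope_between(1) assms \<open>j < l\<close> by auto
  ultimately have "0 < (slope a b i l - slope a b i j) * (a l - a i)" by simp
  moreover have "b l = b i + slope a b i l * (a l - a i)"
    using \<open>a i < a l\<close> unfolding slope_def by (simp add: field_simps)
  ultimately show ?thesis unfolding chord_def by (simp add: algebra_simps)
next
  assume "l < i"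
  have "a l < a i" using increasing assms \<open>l < i\<close> by auto
  moreover have "slope a b l i < slope a b i j" using cup assms \<open>l < i\<close> by auto
  ultimately have "0 < (slope a b i j - slope a b l i) * (a i - a l)" by simp
  moreover have "b i = b l + slope a b l i * (a i - a l)"
    using \<open>a l < a i\<close> unfolding slope_def by (simp add: field_simps)
  ultimately show ?thesis unfolding chord_def by (simp add: algebra_simps)
qed

lemma above_chord_weak:
  assumes "i < j" "j < n" "l < n" "l \<le> i \<or> j \<le> l"
  shows "chord a b i j (a l) \<le> b l"
proof -
  have "a i \<noteq> a j" using increasing assms by (metis less_irrefl)
  then show ?thesis
    using above_chord[of i j l] chord_left_end[of a b i j] chord_right_end[of a i j b] assms
    by (cases "l = i \<or> l = j") (auto simp: order_le_less)
qed

lemma neighbour_chords_cross: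
  assumes "g < \<alpha>" "\<alpha> \<le> \<beta>" "\<beta> < h" "h < n"
  shows "\<exists>m. a g < m \<and> m < a h \<and> chord a b g \<alpha> m = chord a b \<beta> h m"
proof -
  define s where "s = slope a b \<beta> h - slope a b g \<alpha>"
  define d where "d x = chord a b \<beta> h x - chord a b g \<alpha> x" for x
  have s: "0 < s" unfolding s_def using slope_mono[of g \<alpha> \<beta> h] assms by auto
  have d_affine: "d x = d y + s * (x - y)" for x y
    unfolding d_def s_def using chord_shift[of a b \<beta> h x y] chord_shift[of a b g \<alpha> x y]
    by (simp add: algebra_simps)
  have "chord a b \<beta> h (a g) < b g" using above_chord[of \<beta> h g] assms by auto
  then have dg: "d (a g) < 0" unfolding d_def chord_left_end by simp
  have "a \<beta> \<noteq> a h" using increasing assms by fastforce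
  then have "chord a b \<beta> h (a h) = b h" by (rule chord_right_end)
  moreover have "chord a b g \<alpha> (a h) < b h" using above_chord[of g \<alpha> h] assms by auto
  ultimately have dh: "0 < d (a h)" unfolding d_def by simp
  define m where "m = a g - d (a g) / s"
  have "a g < m" unfolding m_def using dg s by (simp add: field_simps)
  moreover have "m < a h"
    using dh d_affine[of "a h" "a g"] s unfolding m_def by (simp add: field_simps)
  moreover have "d m = 0" using s d_affine[of m "a g"] unfolding m_def by simp
  ultimately show ?thesis unfolding d_def by auto
qed

lemma chord_inside_above:
  assumes "g < \<alpha>" "\<alpha> \<le> i" "i < j" "j \<le> \<beta>" "\<beta> < h" "h < n"
    and "chord a b g \<alpha> m = q" "chord a b \<beta> h m = q"
  shows "q < chord a b i j m"
proof -
  define s s1 s2 where "s = slope a b i j" "s1 = slope a b g \<alpha>" "s2 = slope a b \<beta> h"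
  have slopes: "s1 < s" "s < s2"
    unfolding s_s1_s2_def using slope_mono[of g \<alpha> i j] slope_mono[of i j \<beta> h] assms by auto
  have "chord a b g \<alpha> (a i) \<le> b i" by (rule above_chord_weak) (use assms in auto)
  then have left: "q + s1 * (a i - m) \<le> b i"
    using chord_shift[of a b g \<alpha> "a i" m] assms(7) unfolding s_s1_s2_def by simp
  have "chord a b \<beta> h (a i) < b i" by (rule above_chord) (use assms in auto)
  then have right: "q + s2 * (a i - m) < b i"
    using chord_shift[of a b \<beta> h "a i" m] assms(8) unfolding s_s1_s2_def by simp
  have "chord a b i j m - q = (b i - (q + s1 * (a i - m))) + (s - s1) * (m - a i)"
       "chord a b i j m - q = (b i - (q + s2 * (a i - m))) + (s2 - s) * (a i - m)"
    unfolding chord_def s_s1_s2_def by (simp_all add: algebra_simps)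
  moreover have "0 < (s - s1) * (m - a i) \<or> 0 \<le> (s2 - s) * (a i - m)"
    using slopes by (cases "m \<le> a i") simp_all
  ultimately show ?thesis using left right by linarith
qed

lemma chord_left_below:
  assumes "i < j" "j \<le> g" "g < \<alpha>" "\<alpha> < n" "chord a b g \<alpha> m = q" "a g < m"
  shows "chord a b i j m < q"
proof -
  have "slope a b i j < slope a b g \<alpha>" using slope_mono[of i j g \<alpha>] assms by auto
  then have gap: "0 < (slope a b g \<alpha> - slope a b i j) * (m - a g)" using assms by simp
  have below: "chord a b i j (a g) \<le> b g" using above_chord_weak[of i j g] assms by auto
  have "chord a b i j m - q = (chord a b i j (a g) - b g) - (slope a b g \<alpha> - slope a b i j) * (m - a g)"
    using chord_shift[of a b i j m "a g"] assms(5) unfolding chord_def[of a b g] by (simp add: algebra_simps)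
  then show ?thesis using gap below by linarith
qed

lemma chord_right_below:
  assumes "\<beta> < h" "h \<le> i" "i < j" "j < n" "chord a b \<beta> h m = q" "m < a h"
  shows "chord a b i j m < q"
proof -
  have "slope a b \<beta> h < slope a b i j" using slope_mono[of \<beta> h i j] assms by auto
  then have gap: "0 < (slope a b i j - slope a b \<beta> h) * (a h - m)" using assms by simp
  have below: "chord a b i j (a h) \<le> b h" using above_chord_weak[of i j h] assms by auto
  have "a \<beta> \<noteq> a h" using increasing assms by fastforce
  then have "chord a b \<beta> h (a h) = b h" by (rule chord_right_end)
  then have "chord a b i j m - q = (chord a b i j (a h) - b h) - (slope a b i j - slope a b \<beta> h) * (a h - m)"
    using chord_shift[of a b i j m "a h"] chord_shift[of a b \<beta> h m "a h"] assms(5)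
    by (simp add: algebra_simps)
  then show ?thesis using gap below by linarith
qed

end

text \<open>The dual form of the separation we need: at abscissa \<open>m\<close>, all chords inside the block
  \<open>\<alpha>..\<beta>\<close> lie strictly on the side \<open>\<sigma>\<close> of height \<open>q\<close>, all chords entirely before or
  entirely after the block strictly on the other side.\<close>
definition separates ::
  "(nat \<Rightarrow> real) \<Rightarrow> (nat \<Rightarrow> real) \<Rightarrow> nat \<Rightarrow> nat \<Rightarrow> nat \<Rightarrow> real \<Rightarrow> real \<Rightarrow> real \<Rightarrow> bool" where
  "separates a b n \<alpha> \<beta> m q \<sigma> \<longleftrightarrow>
     (\<forall>i j. \<alpha> \<le> i \<longrightarrow> i < j \<longrightarrow> j \<le> \<beta> \<longrightarrow> 0 < \<sigma> * (chord a b i j m - q)) \<and>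
     (\<forall>i j. i < j \<longrightarrow> j < \<alpha> \<longrightarrow> \<sigma> * (chord a b i j m - q) < 0) \<and>
     (\<forall>i j. \<beta> < i \<longrightarrow> i < j \<longrightarrow> j < n \<longrightarrow> \<sigma> * (chord a b i j m - q) < 0)"

lemma (in cup_sequence) cup_separation:
  assumes "0 < \<alpha>" "\<alpha> \<le> \<beta>" "\<beta> + 1 < n"
  shows "\<exists>m q. separates a b n \<alpha> \<beta> m q 1"
proof -
  define g h where "g = \<alpha> - 1" "h = \<beta> + 1"
  have gh: "g < \<alpha>" "\<beta> < h" "h < n" using assms unfolding g_h_def by auto
  obtain m where m: "a g < m" "m < a h" "chord a b g \<alpha> m = chord a b \<beta> h m"
    using neighbour_chords_cross[of g \<alpha> \<beta> h] gh assms(2) by blast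
  define q where "q = chord a b \<beta> h m"
  have left_q: "chord a b g \<alpha> m = q" and right_q: "chord a b \<beta> h m = q"
    using m(3) unfolding q_def by simp_all
  have "separates a b n \<alpha> \<beta> m q 1"
    unfolding separates_def
  proof (intro conjI allI impI)
    fix i j assume "\<alpha> \<le> i" "i < j" "j \<le> \<beta>"
    with chord_inside_above[OF gh(1) this gh(2,3) left_q right_q]
    show "0 < 1 * (chord a b i j m - q)" by simp
  next
    fix i j assume "i < j" "j < \<alpha>"
    then have "j \<le> g" unfolding g_h_def by simp
    with chord_left_below[OF \<open>i < j\<close> this gh(1) _ left_q m(1)] assms
    show "1 * (chord a b i j m - q) < 0" by simp
  next
    fix i j assume "\<beta> < i" "i < j" "j < n"
    then have "h \<le> i" unfolding g_h_def by simp
    with chord_right_below[OF gh(2) this \<open>i < j\<close> \<open>j < n\<close> right_q m(2)]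
    show "1 * (chord a b i j m - q) < 0" by simp
  qed
  then show ?thesis by blast
qed

text \<open>Reflecting the sequence in the horizontal axis turns a cap into a cup and flips the side.\<close>
lemma separates_reflect:
  assumes "separates a (\<lambda>i. - b i) n \<alpha> \<beta> m q \<sigma>"
  shows "separates a b n \<alpha> \<beta> m (- q) (- \<sigma>)"
proof -
  have "(- \<sigma>) * (chord a b i j m - - q) = \<sigma> * (chord a (\<lambda>i. - b i) i j m - q)" for i j
    by (simp add: chord_neg algebra_simps)
  then show ?thesis using assms unfolding separates_def by presburger
qed

lemma cup_or_cap_separation:
  assumes increasing: "\<And>i j. i < j \<Longrightarrow> j < n \<Longrightarrow> a i < a j"
    and cup_or_cap: "is_cup a b n \<or> is_cap a b n"
    and block: "0 < \<alpha>" "\<alpha> \<le> \<beta>" "\<beta> + 1 < n"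
  shows "\<exists>m q \<sigma>. separates a b n \<alpha> \<beta> m q \<sigma>"
  using cup_or_cap
proof
  assume "is_cup a b n"
  then interpret cup_sequence a b n by unfold_locales (use increasing in \<open>auto simp: is_cup_def\<close>)
  show ?thesis using cup_separation[OF block] by blast
next
  assume "is_cap a b n"
  then interpret reflected: cup_sequence a "\<lambda>i. - b i" n
    by unfold_locales (use increasing in \<open>auto simp: slope_neg is_cap_def\<close>)
  show ?thesis using reflected.cup_separation[OF block] separates_reflect by blast
qed

lemma ramsey_triples:
  fixes s K :: nat
  shows "\<exists>R :: nat. \<forall>col :: nat \<Rightarrow> nat \<Rightarrow> nat \<Rightarrow> nat. (\<forall>i j l. col i j l < s) \<longrightarrow>
       (\<exists>e c. strict_mono_on {..<K} e \<and> e ` {..<K} \<subseteq> {..<R} \<and>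
             (\<forall>i j l. i < j \<longrightarrow> j < l \<longrightarrow> l < K \<longrightarrow> col (e i) (e j) (e l) = c))"
proof -
  from ramsey_full[of "replicate s K" 3] obtain R :: nat where R: "partn_lst {..<R} (replicate s K) 3" ..
  have homogeneous: "\<exists>e c. strict_mono_on {..<K} e \<and> e ` {..<K} \<subseteq> {..<R} \<and>
           (\<forall>i j l. i < j \<longrightarrow> j < l \<longrightarrow> l < K \<longrightarrow> col (e i) (e j) (e l) = c)"
    if col: "\<forall>i j l. col i j l < s" for col :: "nat \<Rightarrow> nat \<Rightarrow> nat \<Rightarrow> nat"
  proof -
    define f where "f X = (let xs = sorted_list_of_set X in col (xs ! 0) (xs ! 1) (xs ! 2))" for X
    have "f \<in> nsets {..<R} 3 \<rightarrow> {..<length (replicate s K)}"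
      using col by (simp add: f_def Let_def)
    then obtain c H where H: "H \<in> nsets {..<R} K" and mono: "f ` nsets H 3 \<subseteq> {c}"
      using R unfolding partn_lst_def monochromatic_def by auto
    define e where "e i = sorted_list_of_set H ! i" for i
    have H_fin: "finite H" "card H = K" "H \<subseteq> {..<R}" using H unfolding nsets_def by auto
    have e_mono: "e i < e j" if "i < j" "j < K" for i j
      using that H_fin unfolding e_def by (simp add: sorted_wrt_nth_less)
    have e_in: "e i \<in> H" if "i < K" for i
      using that H_fin unfolding e_def by (metis length_sorted_list_of_set nth_mem set_sorted_list_of_set)
    have "col (e i) (e j) (e l) = c" if "i < j" "j < l" "l < K" for i j l
    proof -
      have ord: "e i < e j" "e j < e l" using e_mono that by auto
      then have "{e i, e j, e l} \<in> nsets H 3"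
        using e_in that by (auto simp: nsets_def card_insert_if)
      then have "f {e i, e j, e l} = c" using mono by blast
      then show ?thesis using ord by (simp add: f_def)
    qed
    moreover have "strict_mono_on {..<K} e" using e_mono by (auto intro: strict_mono_onI)
    moreover have "e ` {..<K} \<subseteq> {..<R}" using e_in H_fin by auto
    ultimately show ?thesis by (intro exI[of _ e] exI[of _ c] conjI) auto
  qed
  show ?thesis
  proof (intro exI[of _ R] allI impI)
    fix col :: "nat \<Rightarrow> nat \<Rightarrow> nat \<Rightarrow> nat" assume "\<forall>i j l. col i j l < s"
    then show "\<exists>e c. strict_mono_on {..<K} e \<and> e ` {..<K} \<subseteq> {..<R} \<and>
           (\<forall>i j l. i < j \<longrightarrow> j < l \<longrightarrow> l < K \<longrightarrow> col (e i) (e j) (e l) = c)"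
      by (rule homogeneous)
  qed
qed

text \<open>Colouring triples by the order of consecutive slopes: every sequence of points has, among
  its first \<open>R\<close> terms, a \<open>K\<close>-element subsequence which is a cup, a cap, or collinear.\<close>
lemma cup_cap_or_collinear_subsequence:
  fixes K :: nat
  shows "\<exists>R :: nat. \<forall>a b :: nat \<Rightarrow> real. \<exists>e. strict_mono_on {..<K} e \<and> e ` {..<K} \<subseteq> {..<R} \<and>
        (is_cup (a \<circ> e) (b \<circ> e) K \<or> is_cap (a \<circ> e) (b \<circ> e) K \<or> is_collinear (a \<circ> e) (b \<circ> e) K)"
proof -
  from ramsey_triples[of 3 K] obtain R :: nat where
    R: "\<forall>col :: nat \<Rightarrow> nat \<Rightarrow> nat \<Rightarrow> nat. (\<forall>i j l. col i j l < 3) \<longrightarrow>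
       (\<exists>e c. strict_mono_on {..<K} e \<and> e ` {..<K} \<subseteq> {..<R} \<and>
             (\<forall>i j l. i < j \<longrightarrow> j < l \<longrightarrow> l < K \<longrightarrow> col (e i) (e j) (e l) = c))" ..
  have "\<exists>e. strict_mono_on {..<K} e \<and> e ` {..<K} \<subseteq> {..<R} \<and>
        (is_cup (a \<circ> e) (b \<circ> e) K \<or> is_cap (a \<circ> e) (b \<circ> e) K \<or> is_collinear (a \<circ> e) (b \<circ> e) K)"
    for a b :: "nat \<Rightarrow> real"
  proof -
    define col :: "nat \<Rightarrow> nat \<Rightarrow> nat \<Rightarrow> nat" where
      "col i j l = (if slope a b i j < slope a b j l then 0
                    else if slope a b i j > slope a b j l then 1 else 2)" for i j l
    have "\<forall>i j l. col i j l < 3" unfolding col_def by simp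
    from mp[OF spec[OF R, of col] this] obtain e c where e: "strict_mono_on {..<K} e" "e ` {..<K} \<subseteq> {..<R}" and
      pattern: "\<forall>i j l. i < j \<longrightarrow> j < l \<longrightarrow> l < K \<longrightarrow> col (e i) (e j) (e l) = c"
      by blast
    have slope_e: "slope (a \<circ> e) (b \<circ> e) i j = slope a b (e i) (e j)" for i j
      unfolding slope_def by simp
    have colour: "col (e i) (e j) (e l) = c" if "i < j" "j < l" "l < K" for i j l
      using pattern that by blast
    have colour_meaning:
      "col i j l = 0 \<longleftrightarrow> slope a b i j < slope a b j l"
      "col i j l = 1 \<longleftrightarrow> slope a b i j > slope a b j l"
      "col i j l = 2 \<longleftrightarrow> slope a b i j = slope a b j l"
      "col i j l \<in> {0, 1, 2}" for i j l
      unfolding col_def by auto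
    have cup: "is_cup (a \<circ> e) (b \<circ> e) K" if "c = 0"
      unfolding is_cup_def slope_e using colour colour_meaning(1) that by blast
    have cap: "is_cap (a \<circ> e) (b \<circ> e) K" if "c = 1"
      unfolding is_cap_def slope_e using colour colour_meaning(2) that by blast
    have collinear: "is_collinear (a \<circ> e) (b \<circ> e) K" if "c = 2"
      unfolding is_collinear_def slope_e using colour colour_meaning(3) that by blast
    have "c \<in> {0, 1, 2} \<or> K \<le> 2"
    proof (cases "K \<le> 2")
      case False
      then have "col (e 0) (e 1) (e 2) = c" by (intro colour) auto
      then show ?thesis using colour_meaning(4)[of "e 0" "e 1" "e 2"] by simp
    qed simp
    then have "is_cup (a \<circ> e) (b \<circ> e) K \<or> is_cap (a \<circ> e) (b \<circ> e) K \<or> is_collinear (a \<circ> e) (b \<circ> e) K"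
      using cup cap collinear unfolding is_collinear_def by auto
    with e show ?thesis by (intro exI[of _ e] conjI)
  qed
  then show ?thesis by (intro exI[of _ R] allI)
qed

definition nonvertical_line :: "real \<Rightarrow> real \<Rightarrow> point set" where
  "nonvertical_line \<alpha> \<beta> = {p. p$2 = \<alpha> * p$1 + \<beta>}"

definition offset :: "real \<Rightarrow> real \<Rightarrow> point \<Rightarrow> real" where
  "offset m q p = p$2 - m * p$1 - q"

lemma nonvertical_line_eq_iff:
  "nonvertical_line \<alpha> \<beta> = nonvertical_line \<alpha>' \<beta>' \<longleftrightarrow> \<alpha> = \<alpha>' \<and> \<beta> = \<beta>'"
proof
  assume same: "nonvertical_line \<alpha> \<beta> = nonvertical_line \<alpha>' \<beta>'"
  have on_line: "vector [x, \<alpha> * x + \<beta>] \<in> nonvertical_line \<alpha>' \<beta>'" for x :: real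
  proof -
    have "vector [x, \<alpha> * x + \<beta>] \<in> nonvertical_line \<alpha> \<beta>" unfolding nonvertical_line_def by simp
    then show ?thesis using same by simp
  qed
  have "\<beta> = \<beta>'" using on_line[of 0] unfolding nonvertical_line_def by simp
  moreover have "\<alpha> + \<beta> = \<alpha>' + \<beta>'" using on_line[of 1] unfolding nonvertical_line_def by simp
  ultimately show "\<alpha> = \<alpha>' \<and> \<beta> = \<beta>'" by simp
qed simp

lemma point_eq_iff: "(p :: point) = q \<longleftrightarrow> p$1 = q$1 \<and> p$2 = q$2"
  by (simp add: vec_eq_iff forall_2)

lemma line_vertical_or_graph:
  assumes "is_line L"
  shows "(\<exists>x0. L = {p. p$1 = x0}) \<or> (\<exists>\<alpha> \<beta>. L = nonvertical_line \<alpha> \<beta>)"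
proof -
  obtain a b :: point where b: "b \<noteq> 0" and L: "L = {a + t *\<^sub>R b | t. True}"
    using assms unfolding is_line_def by blast
  show ?thesis
  proof (cases "b$1 = 0")
    case True
    then have "b$2 \<noteq> 0" using b point_eq_iff[of b 0] by auto
    have "p \<in> L \<longleftrightarrow> p$1 = a$1" for p
    proof
      assume "p$1 = a$1"
      then have "p = a + ((p$2 - a$2) / b$2) *\<^sub>R b"
        using True \<open>b$2 \<noteq> 0\<close> unfolding point_eq_iff by simp
      then show "p \<in> L" unfolding L by blast
    qed (use L True in auto)
    then show ?thesis by blast
  next
    case False
    have "p \<in> L \<longleftrightarrow> p \<in> nonvertical_line (b$2 / b$1) (a$2 - b$2 / b$1 * a$1)" for p
    proof
      assume "p \<in> nonvertical_line (b$2 / b$1) (a$2 - b$2 / b$1 * a$1)"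
      then have "p = a + ((p$1 - a$1) / b$1) *\<^sub>R b"
        using False unfolding point_eq_iff nonvertical_line_def by (simp add: field_simps)
      then show "p \<in> L" unfolding L by blast
    qed (use L False in \<open>auto simp: nonvertical_line_def field_simps\<close>)
    then show ?thesis by blast
  qed
qed

text \<open>Point--line duality: the line \<open>y = \<alpha> x + \<beta>\<close> corresponds to the point \<open>(\<alpha>, \<beta>)\<close>.\<close>
lemma offset_at_intersection:
  assumes "a i \<noteq> a j" "p \<in> nonvertical_line (a i) (b i)" "p \<in> nonvertical_line (a j) (b j)"
  shows "offset m q p = chord a b i j m - q"
proof -
  have p: "p$2 = a i * p$1 + b i" "p$2 = a j * p$1 + b j"
    using assms unfolding nonvertical_line_def by auto
  then have "p$1 * (a j - a i) = b i - b j" by (simp add: algebra_simps)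
  then have "p$1 = - slope a b i j" unfolding slope_def using assms(1) by (simp add: field_simps)
  then show ?thesis unfolding offset_def chord_def p(1) by (simp add: algebra_simps)
qed

lemma convex_offset_side: "convex {p. 0 < \<sigma> * offset m q p}"
proof -
  have "{p. 0 < \<sigma> * offset m q p} = {p. inner (vector [- \<sigma> * m, \<sigma>]) p > \<sigma> * q}"
    by (auto simp: offset_def inner_vec_def sum_2 algebra_simps)
  then show ?thesis by (simp add: convex_halfspace_gt)
qed

lemma CH_in_side:
  assumes inj: "inj_on a I"
    and side: "\<And>i j. i \<in> I \<Longrightarrow> j \<in> I \<Longrightarrow> i < j \<Longrightarrow> 0 < \<sigma> * (chord a b i j m - q)"
  shows "CH ((\<lambda>i. nonvertical_line (a i) (b i)) ` I) \<subseteq> {p. 0 < \<sigma> * offset m q p}"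
  unfolding CH_def
proof (rule hull_minimal)
  show "convex {p. 0 < \<sigma> * offset m q p}" by (rule convex_offset_side)
  show "V ((\<lambda>i. nonvertical_line (a i) (b i)) ` I) \<subseteq> {p. 0 < \<sigma> * offset m q p}"
  proof
    fix p assume "p \<in> V ((\<lambda>i. nonvertical_line (a i) (b i)) ` I)"
    then obtain i j where ij: "i \<in> I" "j \<in> I" "i \<noteq> j"
      and p: "p \<in> nonvertical_line (a i) (b i)" "p \<in> nonvertical_line (a j) (b j)"
      unfolding V_def by auto
    have "a i \<noteq> a j" using inj ij unfolding inj_on_def by blast
    then have "offset m q p = chord a b i j m - q" "offset m q p = chord a b j i m - q"
      using offset_at_intersection[of a i j p b] offset_at_intersection[of a j i p b] p by auto
    then show "p \<in> {p. 0 < \<sigma> * offset m q p}"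
      using side[of i j] side[of j i] ij by (cases "i < j") auto
  qed
qed

lemma convex_position_if_separable:
  assumes "finite S" and sep: "\<And>y. y \<in> S \<Longrightarrow> \<exists>H. convex H \<and> y \<notin> H \<and> S - {y} \<subseteq> H"
  shows "convex_position S"
  unfolding convex_position_def
proof (intro conjI ballI)
  fix y assume "y \<in> S"
  then obtain H where H: "convex H" "y \<notin> H" "S - {y} \<subseteq> H" using sep by blast
  then have "y \<notin> convex hull (S - {y})" using hull_minimal[of "S - {y}" H convex] by blast
  then have "y extreme_point_of convex hull (insert y (S - {y}))"
    using assms(1) by (intro extreme_point_of_convex_hull_insert) auto
  then show "y extreme_point_of convex hull S" using \<open>y \<in> S\<close> by (simp add: insert_absorb)
qed (rule assms(1))

definition convex_transversal_family :: "nat \<Rightarrow> nat \<Rightarrow> point set set \<Rightarrow> bool" where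
  "convex_transversal_family k c A \<longleftrightarrow>
     (\<exists>As :: nat \<Rightarrow> point set set.
        (\<forall>i<k. As i \<subseteq> A \<and> card (As i) \<ge> c) \<and>
        (\<forall>i<k. \<forall>j<k. i \<noteq> j \<longrightarrow> As i \<inter> As j = {}) \<and>
        (\<forall>x :: nat \<Rightarrow> point. (\<forall>i<k. x i \<in> CH (As i)) \<longrightarrow> convex_position (x ` {..<k})))"

text \<open>The \<open>t\<close>-th block of \<open>c\<close> consecutive indices; index \<open>0\<close> is left free so that every
  block has a neighbour on each side.\<close>
definition block :: "nat \<Rightarrow> nat \<Rightarrow> nat set" where
  "block c t = {t * c + 1 .. t * c + c}"

lemma card_block: "card (block c t) = c"
  unfolding block_def by simp

lemma block_bound: "t < k \<Longrightarrow> i \<in> block c t \<Longrightarrow> i \<le> k * c"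
proof -
  assume "t < k" "i \<in> block c t"
  moreover have "(t + 1) * c \<le> k * c" using \<open>t < k\<close> by (intro mult_le_mono1) simp
  ultimately show "i \<le> k * c" unfolding block_def by (simp add: algebra_simps)
qed

lemma block_before: "u < t \<Longrightarrow> j \<in> block c u \<Longrightarrow> j < t * c + 1"
proof -
  assume "u < t" "j \<in> block c u"
  moreover have "(u + 1) * c \<le> t * c" using \<open>u < t\<close> by (intro mult_le_mono1) simp
  ultimately show ?thesis unfolding block_def by (simp add: algebra_simps)
qed

lemma block_after: "t < u \<Longrightarrow> i \<in> block c u \<Longrightarrow> t * c + c < i"
proof -
  assume "t < u" "i \<in> block c u"
  moreover have "(t + 1) * c \<le> u * c" using \<open>t < u\<close> by (intro mult_le_mono1) simp
  ultimately show ?thesis unfolding block_def by (simp add: algebra_simps)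
qed

lemma block_images:
  assumes inj: "inj_on h {..<n}" and n: "k * c < n"
  shows "\<And>t. t < k \<Longrightarrow> card (h ` block c t) = c \<and> h ` block c t \<subseteq> h ` {..<n}"
    and "\<And>t u. t < k \<Longrightarrow> u < k \<Longrightarrow> t \<noteq> u \<Longrightarrow> h ` block c t \<inter> h ` block c u = {}"
proof -
  have sub: "block c t \<subseteq> {..<n}" if "t < k" for t using block_bound[OF that] n by fastforce
  show "card (h ` block c t) = c \<and> h ` block c t \<subseteq> h ` {..<n}" if "t < k" for t
    using card_image[OF inj_on_subset[OF inj sub[OF that]]] sub[OF that] card_block by auto
  show "h ` block c t \<inter> h ` block c u = {}" if "t < k" "u < k" "t \<noteq> u" for t u
  proof -
    have "block c t \<inter> block c u = {}"
      using block_after[of t u _ c] block_after[of u t _ c] that unfolding block_def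
      by (cases "t < u") fastforce+
    then show ?thesis using inj_on_image_Int[OF inj sub[of t] sub[of u]] that by simp
  qed
qed

text \<open>Degenerate case: if the blocks consist of pairwise disjoint (parallel) lines, their
  intersection sets \<open>V\<close> and hence all \<open>CH\<close> are empty, so there is no transversal at all.\<close>
lemma parallel_family:
  assumes fin: "finite C" and CA: "C \<subseteq> A" and many: "k * c < card C" and k: "0 < k"
    and disj: "pairwise disjnt C"
  shows "convex_transversal_family k c A"
proof -
  obtain h where h: "bij_betw h {..<card C} C"
    using ex_bij_betw_nat_finite[OF fin] by (auto simp: atLeast0LessThan)
  then have inj: "inj_on h {..<card C}" and onto: "h ` {..<card C} = C"
    by (auto simp: bij_betw_def)
  define As where "As t = h ` block c t" for t
  note blocks = block_images[OF inj many]
  have sub: "As t \<subseteq> C" and card: "card (As t) = c" if "t < k" for t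
    using blocks(1)[OF that] onto unfolding As_def by simp_all
  have "V (As 0) = {}" using sub[OF k] disj unfolding V_def pairwise_def disjnt_def by blast
  then have no_transversal: "\<not> (\<forall>i<k. x i \<in> CH (As i))" for x :: "nat \<Rightarrow> point"
    using k unfolding CH_def by auto
  have "\<forall>t<k. As t \<subseteq> A \<and> c \<le> card (As t)" using sub card CA by auto
  moreover have "\<forall>t<k. \<forall>u<k. t \<noteq> u \<longrightarrow> As t \<inter> As u = {}" using blocks(2) unfolding As_def by blast
  ultimately show ?thesis
    unfolding convex_transversal_family_def using no_transversal by blast
qed

lemma block_sides:
  assumes inj: "inj_on a {..<n}" and n: "k * c < n" and t: "t < k"
    and sep: "separates a b n (t * c + 1) (t * c + c) m q \<sigma>"
  shows "CH ((\<lambda>i. nonvertical_line (a i) (b i)) ` block c t) \<subseteq> {p. 0 < \<sigma> * offset m q p}"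
    and "\<And>u. u < k \<Longrightarrow> u \<noteq> t \<Longrightarrow>
           CH ((\<lambda>i. nonvertical_line (a i) (b i)) ` block c u) \<subseteq> {p. 0 < (- \<sigma>) * offset m q p}"
proof -
  have inj_block: "inj_on a (block c u)" if "u < k" for u
  proof (rule inj_on_subset[OF inj])
    show "block c u \<subseteq> {..<n}" using block_bound[OF that] n by fastforce
  qed
  have inside: "\<And>i j. t * c + 1 \<le> i \<Longrightarrow> i < j \<Longrightarrow> j \<le> t * c + c \<Longrightarrow> 0 < \<sigma> * (chord a b i j m - q)"
    and before: "\<And>i j. i < j \<Longrightarrow> j < t * c + 1 \<Longrightarrow> \<sigma> * (chord a b i j m - q) < 0"
    and after: "\<And>i j. t * c + c < i \<Longrightarrow> i < j \<Longrightarrow> j < n \<Longrightarrow> \<sigma> * (chord a b i j m - q) < 0"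
    using sep unfolding separates_def by blast+
  show "CH ((\<lambda>i. nonvertical_line (a i) (b i)) ` block c t) \<subseteq> {p. 0 < \<sigma> * offset m q p}"
  proof (rule CH_in_side[OF inj_block[OF t]])
    fix i j assume "i \<in> block c t" "j \<in> block c t" "i < j"
    then show "0 < \<sigma> * (chord a b i j m - q)" by (intro inside) (simp_all add: block_def)
  qed
  fix u assume u: "u < k" "u \<noteq> t"
  show "CH ((\<lambda>i. nonvertical_line (a i) (b i)) ` block c u) \<subseteq> {p. 0 < (- \<sigma>) * offset m q p}"
  proof (rule CH_in_side[OF inj_block[OF u(1)]])
    fix i j assume ij: "i \<in> block c u" "j \<in> block c u" "i < j"
    have "\<sigma> * (chord a b i j m - q) < 0"
    proof (cases "u < t")
      case True
      show ?thesis by (rule before[OF ij(3) block_before[OF True ij(2)]])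
    next
      case False
      then have "t < u" using u by simp
      moreover have "j < n" using block_bound[OF u(1) ij(2)] n by simp
      ultimately show ?thesis using after[OF block_after[OF _ ij(1)] ij(3)] by blast
    qed
    then show "0 < (- \<sigma>) * (chord a b i j m - q)" by simp
  qed
qed

text \<open>Separable blocks of lines give the required family: each point of a transversal is cut off
  from the others by the line \<open>y = m x + q\<close> belonging to its block.\<close>
lemma separated_blocks_family:
  assumes inj: "inj_on a {..<n}" and lines: "\<And>i. i < n \<Longrightarrow> nonvertical_line (a i) (b i) \<in> A"
    and n: "k * c < n"
    and sep: "\<And>t. t < k \<Longrightarrow> \<exists>m q \<sigma>. separates a b n (t * c + 1) (t * c + c) m q \<sigma>"
  shows "convex_transversal_family k c A"
proof -
  define As where "As t = (\<lambda>i. nonvertical_line (a i) (b i)) ` block c t" for t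
  have "inj_on (\<lambda>i. nonvertical_line (a i) (b i)) {..<n}"
    using inj unfolding inj_on_def nonvertical_line_eq_iff by blast
  note blocks = block_images[OF this n]
  have lines_in_A: "(\<lambda>i. nonvertical_line (a i) (b i)) ` {..<n} \<subseteq> A" using lines by blast
  have "\<forall>t<k. As t \<subseteq> A \<and> c \<le> card (As t)"
  proof (intro allI impI conjI)
    fix t assume "t < k"
    show "As t \<subseteq> A" using blocks(1)[OF \<open>t < k\<close>] lines_in_A unfolding As_def by blast
    show "c \<le> card (As t)" using blocks(1)[OF \<open>t < k\<close>] unfolding As_def by simp
  qed
  moreover have "\<forall>t<k. \<forall>u<k. t \<noteq> u \<longrightarrow> As t \<inter> As u = {}" using blocks(2) unfolding As_def by blast
  moreover have "convex_position (x ` {..<k})" if x: "\<forall>i<k. x i \<in> CH (As i)" for x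
  proof (rule convex_position_if_separable)
    fix y assume "y \<in> x ` {..<k}"
    then obtain t where t: "t < k" "y = x t" by auto
    then obtain m q \<sigma> where "separates a b n (t * c + 1) (t * c + c) m q \<sigma>" using sep by blast
    note sides = block_sides[OF inj n t(1) this]
    show "\<exists>H. convex H \<and> y \<notin> H \<and> x ` {..<k} - {y} \<subseteq> H"
    proof (intro exI conjI)
      show "convex {p. 0 < (- \<sigma>) * offset m q p}" by (rule convex_offset_side)
      have "x t \<in> CH (As t)" using x t by blast
      then have "0 < \<sigma> * offset m q y" using sides(1) t unfolding As_def by blast
      then show "y \<notin> {p. 0 < (- \<sigma>) * offset m q p}" by simp
      show "x ` {..<k} - {y} \<subseteq> {p. 0 < (- \<sigma>) * offset m q p}"
      proof
        fix z assume "z \<in> x ` {..<k} - {y}"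
        then obtain u where u: "u < k" "u \<noteq> t" "z = x u" using t by auto
        then have "z \<in> CH (As u)" using x by blast
        then show "z \<in> {p. 0 < (- \<sigma>) * offset m q p}" using sides(2)[OF u(1,2)] unfolding As_def by blast
      qed
    qed
  qed simp
  ultimately show ?thesis unfolding convex_transversal_family_def by blast
qed

lemma common_point_if_collinear:
  assumes increasing: "strict_mono_on {..<n} a" and collinear: "is_collinear a b n"
  shows "\<exists>p. \<forall>i<n. p \<in> nonvertical_line (a i) (b i)"
proof -
  define s where "s = slope a b 0 1"
  define p :: point where "p = vector [- s, b 0 - s * a 0]"
  have "b l = b 0 + s * (a l - a 0)" if "l < n" for l
  proof -
    consider "l = 0" | "l = 1" | "1 < l" by linarith
    then show ?thesis
    proof cases
      case 2
      then have "a 0 < a 1" using strict_mono_onD[OF increasing, of 0 1] that by simp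
      then show ?thesis using 2 unfolding s_def slope_def by (simp add: field_simps)
    next
      case 3
      then have "a 0 < a 1" "a 1 < a l"
        using strict_mono_onD[OF increasing, of 0 1] strict_mono_onD[OF increasing, of 1 l] that by simp_all
      moreover have "slope a b 1 l = s"
        using collinear[unfolded is_collinear_def, rule_format, of 0 1 l] 3 that unfolding s_def by simp
      ultimately have "b 1 = b 0 + s * (a 1 - a 0)" "b l = b 1 + s * (a l - a 1)"
        unfolding s_def slope_def by (simp_all add: field_simps)
      then show ?thesis by (simp add: algebra_simps)
    qed simp
  qed
  then have "p \<in> nonvertical_line (a i) (b i)" if "i < n" for i
    using that unfolding p_def nonvertical_line_def by (simp add: algebra_simps)
  then show ?thesis by blast
qed

lemma concurrent_lines_bound:
  assumes fin: "finite A" and conc: "\<And>p. card {L\<in>A. p \<in> L} \<le> r"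
    and inj: "inj_on a {..<n}" and lines: "\<And>i. i < n \<Longrightarrow> nonvertical_line (a i) (b i) \<in> A"
    and common: "\<And>i. i < n \<Longrightarrow> p \<in> nonvertical_line (a i) (b i)"
  shows "n \<le> r"
proof -
  have "inj_on (\<lambda>i. nonvertical_line (a i) (b i)) {..<n}"
    using inj unfolding inj_on_def nonvertical_line_eq_iff by blast
  then have "n = card ((\<lambda>i. nonvertical_line (a i) (b i)) ` {..<n})" by (simp add: card_image)
  also have "\<dots> \<le> card {L\<in>A. p \<in> L}" using lines common fin by (intro card_mono) auto
  also have "\<dots> \<le> r" by (rule conc)
  finally show ?thesis .
qed

text \<open>The collinear case is excluded by the concurrency bound; in the other cases every
  block of \<open>c\<close> consecutive lines is separable.\<close>
lemma family_from_monotone_duals: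
  assumes fin: "finite A" and conc: "\<And>p. card {L\<in>A. p \<in> L} \<le> r"
    and increasing: "strict_mono_on {..<n} a"
    and lines: "\<And>i. i < n \<Longrightarrow> nonvertical_line (a i) (b i) \<in> A"
    and n: "k * c + 1 < n" "r < n" and c: "0 < c"
    and shape: "is_cup a b n \<or> is_cap a b n \<or> is_collinear a b n"
  shows "convex_transversal_family k c A"
proof -
  have inj: "inj_on a {..<n}" using increasing by (rule strict_mono_on_imp_inj_on)
  have "\<not> is_collinear a b n"
  proof
    assume "is_collinear a b n"
    then obtain p where "\<forall>i<n. p \<in> nonvertical_line (a i) (b i)"
      using common_point_if_collinear[OF increasing] by blast
    then have "n \<le> r" using concurrent_lines_bound[OF fin conc inj lines] by blast
    then show False using n by simp
  qed
  then have cup_or_cap: "is_cup a b n \<or> is_cap a b n" using shape by blast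
  have increasing': "a i < a j" if "i < j" "j < n" for i j
    using strict_mono_onD[OF increasing, of i j] that by simp
  show ?thesis
  proof (rule separated_blocks_family[OF inj lines])
    show "k * c < n" using n by simp
    fix t assume "t < k"
    then have "(t + 1) * c \<le> k * c" by (intro mult_le_mono1) simp
    then have "t * c + c + 1 < n" using n by (simp add: algebra_simps)
    then show "\<exists>m q \<sigma>. separates a b n (t * c + 1) (t * c + c) m q \<sigma>"
      using cup_or_cap_separation[OF increasing' cup_or_cap, of "t * c + 1" "t * c + c"] c by simp
  qed
qed

definition slopes :: "point set set \<Rightarrow> real set" where
  "slopes A = {\<alpha>. \<exists>\<beta>. nonvertical_line \<alpha> \<beta> \<in> A}"

lemma finite_slopes:
  assumes "finite A"
  shows "finite (slopes A)"
proof (rule inj_on_finite)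
  define g where "g \<alpha> = nonvertical_line \<alpha> (SOME \<beta>. nonvertical_line \<alpha> \<beta> \<in> A)" for \<alpha>
  have "g \<alpha> \<in> A" if "\<alpha> \<in> slopes A" for \<alpha>
    using that unfolding slopes_def g_def by (auto intro: someI_ex)
  then show "g ` slopes A \<subseteq> A" by blast
  show "inj_on g (slopes A)" unfolding inj_on_def g_def nonvertical_line_eq_iff by blast
qed (rule assms)

definition vertical_lines :: "point set set \<Rightarrow> point set set" where
  "vertical_lines A = {L\<in>A. \<exists>x0. L = {p. p$1 = x0}}"

definition parallel_class :: "point set set \<Rightarrow> real \<Rightarrow> point set set" where
  "parallel_class A \<alpha> = {L\<in>A. \<exists>\<beta>. L = nonvertical_line \<alpha> \<beta>}"

lemma vertical_lines_disjoint: "pairwise disjnt (vertical_lines A)"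
  unfolding pairwise_def disjnt_def
proof (intro ballI impI)
  fix L L' assume "L \<in> vertical_lines A" "L' \<in> vertical_lines A" "L \<noteq> L'"
  then obtain x0 x1 where "L = {p. p$1 = x0}" "L' = {p. p$1 = x1}" unfolding vertical_lines_def by blast
  with \<open>L \<noteq> L'\<close> show "L \<inter> L' = {}" by auto
qed

lemma parallel_class_disjoint: "pairwise disjnt (parallel_class A \<alpha>)"
  unfolding pairwise_def disjnt_def
proof (intro ballI impI)
  fix L L' assume "L \<in> parallel_class A \<alpha>" "L' \<in> parallel_class A \<alpha>" "L \<noteq> L'"
  then obtain \<beta> \<beta>' where "L = nonvertical_line \<alpha> \<beta>" "L' = nonvertical_line \<alpha> \<beta>'"
    unfolding parallel_class_def by blast
  with \<open>L \<noteq> L'\<close> show "L \<inter> L' = {}" unfolding nonvertical_line_def by auto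
qed

lemma lines_covered_by_directions:
  assumes "\<forall>L\<in>A. is_line L"
  shows "A \<subseteq> vertical_lines A \<union> (\<Union>\<alpha>\<in>slopes A. parallel_class A \<alpha>)"
proof
  fix L assume L: "L \<in> A"
  from line_vertical_or_graph[OF assms[rule_format, OF L]]
  show "L \<in> vertical_lines A \<union> (\<Union>\<alpha>\<in>slopes A. parallel_class A \<alpha>)"
  proof (elim disjE exE)
    fix x0 assume "L = {p. p$1 = x0}"
    then have "L \<in> vertical_lines A" using L unfolding vertical_lines_def by blast
    then show ?thesis by (rule UnI1)
  next
    fix \<alpha> \<beta> assume "L = nonvertical_line \<alpha> \<beta>"
    then have "\<alpha> \<in> slopes A" "L \<in> parallel_class A \<alpha>"
      using L unfolding slopes_def parallel_class_def by blast+
    then show ?thesis by (rule UnI2[OF UN_I])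
  qed
qed

lemma parallel_family_or_many_slopes:
  assumes fin: "finite A" and lines: "\<forall>L\<in>A. is_line L" and big: "(R + 1) * M \<le> card A"
  shows "(\<exists>C\<subseteq>A. M \<le> card C \<and> pairwise disjnt C) \<or> R \<le> card (slopes A)"
proof (rule ccontr)
  assume none: "\<not> ?thesis"
  have few: "card C < M" if "C \<subseteq> A" "pairwise disjnt C" for C
  proof (rule ccontr)
    assume "\<not> card C < M"
    then have "C \<subseteq> A \<and> M \<le> card C \<and> pairwise disjnt C" using that by simp
    then have "\<exists>C\<subseteq>A. M \<le> card C \<and> pairwise disjnt C" by (rule exI)
    with none show False by simp
  qed
  have few_slopes: "card (slopes A) < R" using none by simp
  let ?V = "vertical_lines A" and ?P = "parallel_class A"
  have "finite (?V \<union> (\<Union>\<alpha>\<in>slopes A. ?P \<alpha>))"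
    using fin finite_slopes[OF fin] unfolding vertical_lines_def parallel_class_def by simp
  then have "card A \<le> card (?V \<union> (\<Union>\<alpha>\<in>slopes A. ?P \<alpha>))"
    using lines_covered_by_directions[OF lines] by (rule card_mono)
  also have "\<dots> \<le> card ?V + card (\<Union>\<alpha>\<in>slopes A. ?P \<alpha>)" by (rule card_Un_le)
  also have "card (\<Union>\<alpha>\<in>slopes A. ?P \<alpha>) \<le> (\<Sum>\<alpha>\<in>slopes A. card (?P \<alpha>))"
    by (rule card_UN_le[OF finite_slopes[OF fin]])
  also have "(\<Sum>\<alpha>\<in>slopes A. card (?P \<alpha>)) \<le> card (slopes A) * M"
    using sum_bounded_above[of "slopes A" "\<lambda>\<alpha>. card (?P \<alpha>)" M]
      few[OF _ parallel_class_disjoint] by (simp add: less_imp_le parallel_class_def)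
  finally have "card A < M + card (slopes A) * M"
    using few[OF _ vertical_lines_disjoint] unfolding vertical_lines_def by fastforce
  also have "\<dots> \<le> (R + 1) * M" using few_slopes by (simp add: algebra_simps)
  finally show False using big by simp
qed

lemma increasing_slope_lines:
  assumes fin: "finite A" and many: "R \<le> card (slopes A)"
  shows "\<exists>a b. strict_mono_on {..<R} a \<and> (\<forall>i<R. nonvertical_line (a i) (b i) \<in> A)"
proof -
  define a where "a i = sorted_list_of_set (slopes A) ! i" for i
  define b where "b i = (SOME \<beta>. nonvertical_line (a i) \<beta> \<in> A)" for i
  have "strict_mono_on {..<R} a"
    using many finite_slopes[OF fin] unfolding a_def
    by (intro strict_mono_onI) (simp add: sorted_wrt_nth_less)
  moreover have "a i \<in> slopes A" if "i < R" for i
  proof -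
    have "i < length (sorted_list_of_set (slopes A))" using that many by simp
    then show ?thesis using finite_slopes[OF fin] unfolding a_def by (metis nth_mem set_sorted_list_of_set)
  qed
  then have "nonvertical_line (a i) (b i) \<in> A" if "i < R" for i
    using that unfolding b_def slopes_def by (auto intro: someI_ex)
  ultimately show ?thesis by blast
qed

lemma family_from_many_slopes:
  assumes R: "\<forall>a b :: nat \<Rightarrow> real. \<exists>e. strict_mono_on {..<K} e \<and> e ` {..<K} \<subseteq> {..<R} \<and>
        (is_cup (a \<circ> e) (b \<circ> e) K \<or> is_cap (a \<circ> e) (b \<circ> e) K \<or> is_collinear (a \<circ> e) (b \<circ> e) K)"
    and fin: "finite A" and conc: "\<And>p. card {L\<in>A. p \<in> L} \<le> r"
    and many: "R \<le> card (slopes A)" and K: "k * c + 1 < K" "r < K" and c: "0 < c"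
  shows "convex_transversal_family k c A"
proof -
  obtain a b where a: "strict_mono_on {..<R} a" and lines: "\<forall>i<R. nonvertical_line (a i) (b i) \<in> A"
    using increasing_slope_lines[OF fin many] by blast
  obtain e where e: "strict_mono_on {..<K} e" "e ` {..<K} \<subseteq> {..<R}"
    and shape: "is_cup (a \<circ> e) (b \<circ> e) K \<or> is_cap (a \<circ> e) (b \<circ> e) K \<or> is_collinear (a \<circ> e) (b \<circ> e) K"
    using R by blast
  have e_below: "e i < R" if "i < K" for i using e(2) that by blast
  have "strict_mono_on {..<K} (a \<circ> e)"
  proof (rule strict_mono_onI)
    fix i j assume "i \<in> {..<K}" "j \<in> {..<K}" "i < j"
    then show "(a \<circ> e) i < (a \<circ> e) j"
      using strict_mono_onD[OF e(1)] strict_mono_onD[OF a] e_below by simp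
  qed
  moreover have "nonvertical_line ((a \<circ> e) i) ((b \<circ> e) i) \<in> A" if "i < K" for i
    using lines e_below[OF that] by simp
  ultimately show ?thesis
    using family_from_monotone_duals[OF fin conc _ _ K c shape] by blast
qed

theorem mainTheorem12:
  fixes k r c :: nat
  assumes "k > 0" and "r > 0" and "c > 0"
  shows "\<exists>N::nat. \<forall>A :: point set set.
           finite A \<and> card A = N \<and> (\<forall>L\<in>A. is_line L) \<and>
           (\<forall>p. card {L\<in>A. p \<in> L} \<le> r) \<longrightarrow>
           (\<exists>As :: nat \<Rightarrow> point set set.
              (\<forall>i<k. As i \<subseteq> A \<and> card (As i) \<ge> c) \<and>
              (\<forall>i<k. \<forall>j<k. i \<noteq> j \<longrightarrow> As i \<inter> As j = {}) \<and>
              (\<forall>x :: nat \<Rightarrow> point. (\<forall>i<k. x i \<in> CH (As i)) \<longrightarrow>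
                  convex_position (x ` {..<k})))"
proof -
  define K where "K = k * c + r + 2"
  from cup_cap_or_collinear_subsequence[of K] obtain R :: nat where
    R: "\<forall>a b :: nat \<Rightarrow> real. \<exists>e. strict_mono_on {..<K} e \<and> e ` {..<K} \<subseteq> {..<R} \<and>
        (is_cup (a \<circ> e) (b \<circ> e) K \<or> is_cap (a \<circ> e) (b \<circ> e) K \<or> is_collinear (a \<circ> e) (b \<circ> e) K)" ..
  show ?thesis
  proof (intro exI[of _ "(R + 1) * (k * c + 1)"] allI impI)
    fix A :: "point set set"
    assume A: "finite A \<and> card A = (R + 1) * (k * c + 1) \<and> (\<forall>L\<in>A. is_line L) \<and> (\<forall>p. card {L\<in>A. p \<in> L} \<le> r)"
    then have "(\<exists>C\<subseteq>A. k * c + 1 \<le> card C \<and> pairwise disjnt C) \<or> R \<le> card (slopes A)"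
      by (intro parallel_family_or_many_slopes) auto
    then have "convex_transversal_family k c A"
    proof (elim disjE exE conjE)
      fix C assume "C \<subseteq> A" "k * c + 1 \<le> card C" "pairwise disjnt C"
      then show ?thesis using parallel_family[of C A k c] finite_subset[of C A] A \<open>k > 0\<close> by simp
    next
      assume "R \<le> card (slopes A)"
      with A \<open>c > 0\<close> show ?thesis
        by (intro family_from_many_slopes[OF R, where r = r]) (auto simp: K_def)
    qed
    then show "\<exists>As. (\<forall>i<k. As i \<subseteq> A \<and> card (As i) \<ge> c) \<and> (\<forall>i<k. \<forall>j<k. i \<noteq> j \<longrightarrow> As i \<inter> As j = {}) \<and>
        (\<forall>x :: nat \<Rightarrow> point. (\<forall>i<k. x i \<in> CH (As i)) \<longrightarrow> convex_position (x ` {..<k}))"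
      unfolding convex_transversal_family_def .
  qed
qed

end
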